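(* Let $t$ be a positive real number and suppose that $r$ and $s$ are relatively prime positive integers. Assume the following hypothesis: for every rational number $\alpha$ and every $t\in(0,\infty]$ there exist rational numbers $\alpha_1,\ldots,\alpha_N$ such that $M_t(\alpha)^t = \sum_{n=1}^N M(\alpha_n)^t$. Then there exist positive integers $r_1,\ldots,r_N,s_1,\ldots,s_N$ such that \begin{equation*} M_t\left(\frac{r}{s}\right)^t = \sum_{n=1}^N M\left(\frac{r_n}{s_n}\right)^t \end{equation*} and \begin{equation*} r = \prod_{n=1}^N r_n\quad\mathrm{and}\quad s = \prod_{n=1}^N s_n. \end{equation*}
   Context: For a non-zero algebraic number $\alpha$, $M(\alpha)$ denotes the logarithmic Mahler measure of its minimal polynomial over $\mathbb Z$: if $f(z)=a\prod_{n=1}^N(z-\alpha_n)$ then $M(f)=\log|a|+\sum_{n}\log^+|\alpha_n|$. In particular, for a rational number $r/s$ in lowest terms, $M(r/s)=\log\max\{|r|,|s|\}$. For $t\in(0,\infty)$, the $t$-metric Mahler measure is \begin{equation*} M_t(\alpha)=\inf\Big\{\Big(\sum_{n\ge1} M(\alpha_n)^t\Big)^{1/t} : \alpha_n\in\overline{\mathbb Q}^{\times},\ \alpha_n=1 \text{ for all but finitely many } n,\ \prod_n\alpha_n=\alpha\Big\}, \end{equation*} the infimum over all ways of writing $\alpha$ as a finite product of non-zero algebraic numbers (with the sup-norm in place of the $t$-sum when $t=\infty$). *)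

theory Defs
  imports Complex_Main "HOL-Computational_Algebra.Computational_Algebra" "HOL-Library.Extended_Real"
begin

text \<open>The minimal polynomial over the integers: irreducibility in \<open>\<int>[X]\<close> (not \<open>\<rat>[X]\<close>) includes
  primitivity here, since a polynomial with a root is not constant. The sign of the leading
  coefficient is only a normalisation; existence and uniqueness are \<open>ex1_min_int_poly\<close> below.\<close>
definition is_min_int_poly :: "complex \<Rightarrow> int poly \<Rightarrow> bool" where
  "is_min_int_poly x p \<longleftrightarrow>
     irreducible p \<and> lead_coeff p > 0 \<and> poly (map_poly of_int p) x = 0"

definition min_int_poly :: "complex \<Rightarrow> int poly" where
  "min_int_poly x = (THE p. is_min_int_poly x p)"

text \<open>\<open>log\<^sup>+ u = ln (max 1 u)\<close>; \<open>proots\<close> counts roots with multiplicity.\<close>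
definition log_mahler_poly :: "complex poly \<Rightarrow> real" where
  "log_mahler_poly f = ln (cmod (lead_coeff f)) + (\<Sum>z\<in>#proots f. ln (max 1 (cmod z)))"

definition log_mahler :: "complex \<Rightarrow> real" where
  "log_mahler x = log_mahler_poly (map_poly of_int (min_int_poly x))"

definition alg_factorizations :: "complex \<Rightarrow> (nat \<Rightarrow> complex) set" where
  "alg_factorizations x =
     {a. (\<forall>n. algebraic (a n) \<and> a n \<noteq> 0) \<and> finite {n. a n \<noteq> 1} \<and> (\<Prod>n | a n \<noteq> 1. a n) = x}"

text \<open>For finite \<open>t\<close> and a sequence that vanishes almost everywhere the series is a finite sum.
  It is applied below to \<open>n \<mapsto> M(\<alpha>\<^sub>n)\<close>, which vanishes wherever \<open>\<alpha>\<^sub>n = 1\<close>.\<close>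
definition seq_norm :: "ereal \<Rightarrow> (nat \<Rightarrow> real) \<Rightarrow> real" where
  "seq_norm t x =
     (if t = \<infinity> then (SUP n. \<bar>x n\<bar>)
      else (\<Sum>n. \<bar>x n\<bar> powr real_of_ereal t) powr (1 / real_of_ereal t))"

definition metric_mahler :: "ereal \<Rightarrow> complex \<Rightarrow> real" where
  "metric_mahler t x = (INF a\<in>alg_factorizations x. seq_norm t (\<lambda>n. log_mahler (a n)))"

lemma map_poly_of_int_mult:
  "map_poly (of_int :: int \<Rightarrow> complex) (p * q) = map_poly of_int p * map_poly of_int q"
  by (intro poly_eqI) (simp add: coeff_map_poly coeff_mult)

lemma map_poly_of_int_add:
  "map_poly (of_int :: int \<Rightarrow> complex) (p + q) = map_poly of_int p + map_poly of_int q"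
  by (intro poly_eqI) (simp add: coeff_map_poly)

lemma ex1_min_int_poly:
  assumes "algebraic x"
  shows "\<exists>!p. is_min_int_poly x p"
proof -
  define R where "R p \<longleftrightarrow> poly (map_poly of_int p) x = 0" for p :: "int poly"
  have R_mult: "R (p * q) \<longleftrightarrow> R p \<or> R q" for p q
    by (simp add: R_def map_poly_of_int_mult)
  have R_const: "R [:c:] \<longleftrightarrow> c = 0" for c
    by (simp add: R_def map_poly_pCons)
  have deg: "degree p > 0" if "R p" "p \<noteq> 0" for p
    using that R_const by (cases p) (auto elim!: degree_eq_zeroE intro: Nat.gr0I)
  from assms obtain P where P: "\<forall>i. coeff P i \<in> \<int>" "P \<noteq> 0" "poly P x = 0"
    by (auto simp: algebraic_def)
  define P' where "P' = map_poly floor (map_poly Re P)"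
  have "map_poly of_int P' = P"
  proof (intro poly_eqI)
    fix n
    from P(1) obtain k where "coeff P n = of_int k" by (metis Ints_cases)
    thus "coeff (map_poly of_int P') n = coeff P n"
      by (simp add: P'_def coeff_map_poly)
  qed
  hence "R P' \<and> P' \<noteq> 0" using P by (auto simp: R_def)
  then obtain f where f: "R f" "f \<noteq> 0" and
    fmin: "\<And>q. R q \<Longrightarrow> q \<noteq> 0 \<Longrightarrow> degree f \<le> degree q"
    using ex_has_least_nat[of "\<lambda>p. R p \<and> p \<noteq> 0" P' degree] by blast
  define g0 where "g0 = primitive_part f"
  define g where "g = smult (sgn (lead_coeff g0)) g0"
  have g0: "g0 \<noteq> 0" using f by (simp add: g0_def)
  have sg: "\<bar>sgn (lead_coeff g0)\<bar> = 1" using g0 by (simp add: sgn_if)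
  have fg0: "f = [:content f:] * g0" by (simp add: g0_def)
  have Rg0: "R g0" using f R_mult[of "[:content f:]" g0] R_const[of "content f"] fg0 by auto
  have gg0: "g = [:sgn (lead_coeff g0):] * g0" by (simp add: g_def)
  have Rg: "R g" using Rg0 R_mult gg0 by metis
  have degg: "degree g = degree f" using sg by (auto simp: g_def g0_def degree_smult_eq sgn_0_0)
  have gnz: "g \<noteq> 0" using g0 by (auto simp: g_def sgn_0_0)
  have lcg: "lead_coeff g > 0" using g0 by (auto simp: g_def sgn_if not_less order.order_iff_strict)
  have cg: "content g = 1"
  proof -
    have "content g = \<bar>sgn (lead_coeff g0)\<bar> * content g0" by (simp add: g_def content_smult)
    thus ?thesis using sg f by (simp add: g0_def)
  qed
  have irr: "irreducible g"
  proof (rule irreducibleI)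
    show "g \<noteq> 0" by fact
    show "\<not> g dvd 1" using deg[OF Rg gnz] by (auto simp: is_unit_poly_iff)
  next
    have *: "b dvd 1" if "g = a * b" "R a" for a b
    proof -
      have nz: "a \<noteq> 0" "b \<noteq> 0" using that gnz by auto
      have "degree g = degree a + degree b" using that nz by (simp add: degree_mult_eq)
      with fmin[OF that(2) nz(1)] degg have "degree b = 0" by simp
      then obtain c where c: "b = [:c:]" by (elim degree_eq_zeroE)
      have "[:c:] dvd g" using \<open>g = a * b\<close> c by (metis dvd_triv_right)
      hence "c dvd content g" by (simp add: const_poly_dvd_iff_dvd_content)
      thus ?thesis using cg c by (simp add: is_unit_const_poly_iff)
    qed
    fix a b assume ab: "g = a * b"
    with Rg R_mult have "R a \<or> R b" by simp
    moreover have "g = b * a" using ab by (simp only: mult.commute)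
    ultimately show "a dvd 1 \<or> b dvd 1" using *[of a b] *[of b a] ab by blast
  qed
  have prime: "prime_elem g" using irr by (rule irreducible_imp_prime_elem_gcd)
  have uniq: "p = g" if p: "is_min_int_poly x p" for p
  proof -
    have Rp: "R p" and ip: "irreducible p" and lp: "lead_coeff p > 0"
      using p by (auto simp: is_min_int_poly_def R_def)
    obtain q r where qr: "pseudo_divmod p g = (q, r)" by force
    define c where "c = lead_coeff g ^ (Suc (degree p) - degree g)"
    have e: "smult c p = g * q + r" and dr: "r = 0 \<or> degree r < degree g"
      using pseudo_divmod[OF gnz qr] by (auto simp: c_def)
    have c: "c \<noteq> 0" using gnz by (simp add: c_def)
    have "R r"
    proof -
      have "R ([:c:] * p)" using Rp R_mult by blast
      hence "R (g * q + r)" using e by simp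
      thus ?thesis using Rg by (simp add: R_def map_poly_of_int_add map_poly_of_int_mult)
    qed
    hence "r = 0" using dr fmin[of r] degg by linarith
    hence "g dvd [:c:] * p" using e by simp
    moreover have "\<not> g dvd [:c:]"
      using deg[OF Rg gnz] c by (auto dest!: dvd_imp_degree_le)
    ultimately have "g dvd p" 
      using prime_elem_dvd_mult_iff[OF prime] by blast
    then obtain h where h: "p = g * h" by (elim dvdE)
    hence "g dvd 1 \<or> h dvd 1" using irreducibleD[OF ip] by blast
    moreover have "\<not> g dvd 1" using irr by (simp add: irreducible_not_unit)
    ultimately have "h dvd 1" by blast
    then obtain d where d: "h = [:d:]" "d dvd 1" by (auto simp: is_unit_poly_iff)
    have "lead_coeff p = lead_coeff g * d" using h d by (simp add: lead_coeff_mult)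
    hence "d > 0" using lp lcg by (simp add: zero_less_mult_iff)
    hence "d = 1" using d by simp
    thus ?thesis using h d by simp
  qed
  have "is_min_int_poly x g"
    using irr lcg Rg by (simp add: is_min_int_poly_def R_def)
  thus ?thesis using uniq by blast
qed

lemma min_int_poly_eqI: "is_min_int_poly x p \<Longrightarrow> min_int_poly x = p"
proof -
  assume p: "is_min_int_poly x p"
  have "coeff p (degree p) \<noteq> 0" using p by (auto simp: is_min_int_poly_def)
  hence "\<exists>n. coeff p n \<noteq> 0" by blast
  hence "algebraic x"
    unfolding algebraic_def
    using p by (intro exI[of _ "map_poly of_int p"])
      (auto simp: is_min_int_poly_def coeff_map_poly poly_eq_iff)
  thus ?thesis
    unfolding min_int_poly_def by (rule the1_equality[OF ex1_min_int_poly p])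
qed

lemma log_mahler_rational:
  fixes r s :: int
  assumes "coprime r s" "s > 0" "r \<noteq> 0"
  shows "log_mahler (of_int r / of_int s) = ln (max \<bar>r\<bar> \<bar>s\<bar>)"
proof -
  have "irreducible [:-r, s:]"
  proof (rule irreducibleI)
    fix a b :: "int poly" assume ab: "[:-r, s:] = a * b"
    have *: "b dvd 1" if prem: "[:-r, s:] = a * b" "degree b = 0" for a b :: "int poly"
    proof -
      obtain c where c: "b = [:c:]" using prem(2) by (elim degree_eq_zeroE)
      have "[:c:] dvd [:-r, s:]" using prem c by (metis dvd_triv_right)
      hence d: "c dvd coeff [:-r, s:] n" for n by (simp only: const_poly_dvd_iff)
      have "c dvd r" "c dvd s" using d[of 0] d[of 1] by simp_all
      thus ?thesis using assms c by (auto simp: is_unit_const_poly_iff coprime_def)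
    qed
    have "a * b \<noteq> 0" "degree (a * b) = 1" using assms by (simp_all flip: ab)
    hence "degree a + degree b = 1" by (simp add: degree_mult_eq)
    hence "degree a = 0 \<or> degree b = 0" by linarith
    moreover have "[:-r, s:] = b * a" using ab by (simp only: mult.commute)
    ultimately show "a dvd 1 \<or> b dvd 1" using *[of a b] *[of b a] ab by blast
  qed (use assms in \<open>auto simp: is_unit_poly_iff\<close>)
  hence "is_min_int_poly (of_int r / of_int s) [:-r, s:]"
    using assms by (simp add: is_min_int_poly_def map_poly_pCons)
  hence m: "min_int_poly (of_int r / of_int s) = [:-r, s:]" by (rule min_int_poly_eqI)
  have e: "map_poly of_int [:-r, s:] = smult (of_int s) [:-(of_int r / of_int s), 1:: complex:]"
    using assms by (simp add: map_poly_pCons)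
  have "log_mahler (of_int r / of_int s) = ln \<bar>s\<bar> + ln (max 1 (\<bar>r\<bar> / \<bar>s\<bar>))"
    using assms unfolding log_mahler_def m e log_mahler_poly_def
    by (simp add: norm_divide del: smult_pCons)
  also have "\<dots> = ln (\<bar>s\<bar> * max 1 (\<bar>r\<bar> / \<bar>s\<bar>))"
    using assms by (subst ln_mult) auto
  also have "\<bar>s\<bar> * max 1 (\<bar>r\<bar> / \<bar>s\<bar>) = max \<bar>r\<bar> \<bar>s\<bar>"
    using assms by (auto simp: max_def field_simps)
  finally show ?thesis .
qed

end

theory Submission
  imports Defs "Jordan_Normal_Form.Char_Poly"
begin

text \<open>Let \<open>r/s = \<Prod>\<alpha>\<^sub>n\<close> be any factorization into algebraic numbers, and let \<open>a\<^sub>n\<close> and \<open>b\<^sub>n\<close> be the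
  leading and the constant coefficient of the minimal polynomial of \<open>\<alpha>\<^sub>n\<close>. The numbers \<open>a\<^sub>n\<alpha>\<^sub>n\<close> and
  \<open>b\<^sub>n/\<alpha>\<^sub>n\<close> are algebraic integers, so \<open>(\<Prod>a\<^sub>n)r/s\<close> and \<open>(\<Prod>b\<^sub>n)s/r\<close> are rational algebraic integers;
  hence \<open>s\<close> divides \<open>\<Prod>a\<^sub>n\<close> and \<open>r\<close> divides \<open>\<Prod>b\<^sub>n\<close>. Splitting \<open>r = \<Prod>r\<^sub>n\<close> and \<open>s = \<Prod>s\<^sub>n\<close> with
  \<open>r\<^sub>n\<close> dividing \<open>b\<^sub>n\<close> and \<open>s\<^sub>n\<close> dividing \<open>a\<^sub>n\<close> gives
  \<open>M(r\<^sub>n/s\<^sub>n) \<le> log max(|a\<^sub>n|, |b\<^sub>n|) \<le> M(\<alpha>\<^sub>n)\<close>. So only factorizations of \<open>r\<close> and \<open>s\<close> into positive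
  integers matter for the infimum, and these produce finitely many sums.\<close>

section \<open>Algebraic integers are closed under products\<close>

text \<open>An eigenvalue of an integer matrix is a root of its characteristic polynomial, which is
  monic with integer coefficients. The nonzero entry \<open>v k\<close> makes \<open>v\<close> a
  genuine eigenvector.\<close>

lemma algebraic_int_of_int_eigenvector:
  fixes x :: "'a :: field_char_0" and v :: "nat \<Rightarrow> 'a" and A :: "nat \<Rightarrow> nat \<Rightarrow> int"
  assumes eig: "\<And>i. i < n \<Longrightarrow> x * v i = (\<Sum>j<n. of_int (A i j) * v j)"
    and nz: "k < n" "v k \<noteq> 0"
  shows "algebraic_int x"
proof -
  define B where "B = mat n n (\<lambda>(i, j). A i j)"
  have B: "B \<in> carrier_mat n n" by (simp add: B_def)
  have B': "map_mat of_int B \<in> carrier_mat n n" using B by simp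
  have "vec n v \<noteq> 0\<^sub>v n"
    using nz by (metis index_vec index_zero_vec(1))
  moreover have "map_mat of_int B *\<^sub>v vec n v = x \<cdot>\<^sub>v vec n v"
    by (rule eq_vecI) (auto simp: B_def scalar_prod_def eig atLeast0LessThan)
  ultimately have "eigenvalue (map_mat of_int B) x"
    unfolding eigenvalue_def eigenvector_def using B by (intro exI[of _ "vec n v"]) auto
  hence "poly (map_poly of_int (char_poly B)) x = 0"
    by (simp add: eigenvalue_root_char_poly[OF B'] of_int_hom.char_poly_hom[OF B])
  moreover have "lead_coeff (char_poly B) = 1"
    using degree_monic_char_poly[OF B] by simp
  ultimately show ?thesis by (auto simp: algebraic_int_altdef_ipoly)
qed

text \<open>The ring generated by \<open>x\<close> over the integers is spanned by finitely many
  powers: a monic relation of degree \<open>m\<close> rewrites \<open>x ^ m\<close> by lower powers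
  without introducing denominators.\<close>

lemma algebraic_int_power_basis:
  fixes x :: "'a :: field_char_0"
  assumes "algebraic_int x"
  obtains m c where "m > 0" "\<And>N. x ^ N = (\<Sum>i<m. of_int (c N i) * x ^ i)"
proof -
  obtain p where p: "poly (map_poly of_int p) x = 0" "lead_coeff p = (1 :: int)"
    using assms by (auto simp: algebraic_int_altdef_ipoly)
  define m where "m = degree p"
  have lc: "coeff p m = 1" using p by (simp add: m_def)
  \<comment> \<open>A monic constant is 1 and has no root.\<close>
  have m: "m > 0"
    using p by (auto simp: m_def map_poly_pCons elim!: degree_eq_zeroE intro!: Nat.gr0I)
  have "0 = (\<Sum>i\<le>m. of_int (coeff p i) * x ^ i)"
    using p by (simp add: poly_altdef m_def degree_map_poly coeff_map_poly)
  also have "\<dots> = x ^ m + (\<Sum>i<m. of_int (coeff p i) * x ^ i)"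
    by (simp add: lc flip: lessThan_Suc_atMost)
  finally have xm: "x ^ m = (\<Sum>i<m. of_int (- coeff p i) * x ^ i)"
    by (simp add: sum_negf eq_neg_iff_add_eq_0)
  have "\<exists>c. x ^ N = (\<Sum>i<m. of_int (c i) * x ^ i)" for N
  proof (induction N)
    case 0
    have "(\<Sum>i<m. of_int (if i = 0 then 1 else 0) * x ^ i) = (\<Sum>i<m. if i = 0 then 1 else 0)"
      by (intro sum.cong) auto
    also have "\<dots> = x ^ 0" using m by simp
    finally show ?case by (metis (no_types))
  next
    case (Suc N)
    then obtain c where c: "x ^ N = (\<Sum>i<m. of_int (c i) * x ^ i)" by blast
    obtain l where l: "m = Suc l" using m by (cases m) auto
    \<comment> \<open>Multiplication by \<open>x\<close> shifts the coefficients up by one place.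
      The top one lands on \<open>x ^ m\<close> and is redistributed by the relation
      \<open>xm\<close>.\<close>
    have "x ^ Suc N = (\<Sum>i<m. of_int (c i) * x ^ Suc i)"
      by (simp add: c sum_distrib_left mult_ac)
    also have "\<dots> = (\<Sum>i<l. of_int (c i) * x ^ Suc i) + of_int (c l) * x ^ m"
      by (simp add: l)
    also have "(\<Sum>i<l. of_int (c i) * x ^ Suc i) = (\<Sum>i<m. of_int (if i = 0 then 0 else c (i - 1)) * x ^ i)"
      unfolding l by (subst sum.lessThan_Suc_shift) simp
    also have "\<dots> + of_int (c l) * x ^ m =
        (\<Sum>i<m. of_int ((if i = 0 then 0 else c (i - 1)) - c l * coeff p i) * x ^ i)"
      unfolding xm sum_distrib_left sum.distrib[symmetric]
      by (intro sum.cong) (auto simp: algebra_simps)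
    finally show ?case
      by (intro exI[of _ "\<lambda>i. (if i = 0 then 0 else c (i - 1)) - c l * coeff p i"])
  qed
  then obtain c where "\<And>N. x ^ N = (\<Sum>i<m. of_int (c N i) * x ^ i)" by metis
  with m show ?thesis using that by blast
qed

text \<open>The pair (i, j) is encoded as k = j * m + i. This numbers the products of powers of two
  algebraic integers by a single index, as needed for the entries of one vector.\<close>

lemma sum_lessThan_mult_div_mod:
  fixes f :: "nat \<Rightarrow> 'a :: comm_semiring_1"
  assumes "m > 0"
  shows "(\<Sum>i<m. f i) * (\<Sum>j<n. g j) = (\<Sum>k<n * m. f (k mod m) * g (k div m))"
proof -
  have "(\<Sum>k<n * m. f (k mod m) * g (k div m)) =
      (\<Sum>j<n. \<Sum>k\<in>{j * m..<j * m + m}. f (k mod m) * g (k div m))"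
    by (simp add: sum.nat_group)
  also have "\<dots> = (\<Sum>j<n. \<Sum>i<m. f i * g j)"
  proof (rule sum.cong[OF refl])
    fix j
    show "(\<Sum>k\<in>{j * m..<j * m + m}. f (k mod m) * g (k div m)) = (\<Sum>i<m. f i * g j)"
      by (rule sum.reindex_bij_witness[of _ "\<lambda>i. j * m + i" "\<lambda>k. k - j * m"])
         (use assms in \<open>auto simp: le_iff_add algebra_simps\<close>)
  qed
  also have "\<dots> = (\<Sum>i<m. f i) * (\<Sum>j<n. g j)"
    by (subst sum.swap) (simp add: sum_product)
  finally show ?thesis by simp
qed

text \<open>Multiplication by \<open>x * y\<close> maps the integer span of the finitely many
  products \<open>x ^ i * y ^ j\<close> to itself. The vector \<open>v\<close> of these products is
  thus an eigenvector of an integer matrix, with \<open>v 0 = 1\<close>.\<close>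

lemma algebraic_int_mult:
  fixes x y :: "'a :: field_char_0"
  assumes "algebraic_int x" "algebraic_int y"
  shows "algebraic_int (x * y)"
proof -
  obtain m c where m: "m > 0" and c: "\<And>N. x ^ N = (\<Sum>i<m. of_int (c N i) * x ^ i)"
    using algebraic_int_power_basis[OF assms(1)] by blast
  obtain n d where n: "n > 0" and d: "\<And>N. y ^ N = (\<Sum>i<n. of_int (d N i) * y ^ i)"
    using algebraic_int_power_basis[OF assms(2)] by blast
  define v where "v k = x ^ (k mod m) * y ^ (k div m)" for k
  show ?thesis
  proof (rule algebraic_int_of_int_eigenvector[where k = 0])
    fix k assume "k < n * m"
    have "x * y * v k = x ^ Suc (k mod m) * y ^ Suc (k div m)"
      by (simp add: v_def mult_ac)
    also have "\<dots> = (\<Sum>i<m. of_int (c (Suc (k mod m)) i) * x ^ i) *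
        (\<Sum>j<n. of_int (d (Suc (k div m)) j) * y ^ j)"
      by (metis c d)
    also have "\<dots> = (\<Sum>l<n * m.
        of_int (c (Suc (k mod m)) (l mod m) * d (Suc (k div m)) (l div m)) * v l)"
      unfolding sum_lessThan_mult_div_mod[OF m] by (simp add: v_def mult_ac)
    finally show "x * y * v k = \<dots>" .
  qed (use m n in \<open>auto simp: v_def\<close>)
qed

lemma algebraic_int_prod:
  fixes f :: "'b \<Rightarrow> 'a :: field_char_0"
  assumes "\<And>i. i \<in> A \<Longrightarrow> algebraic_int (f i)"
  shows "algebraic_int (\<Prod>i\<in>A. f i)"
  using assms
  by (induction A rule: infinite_finite_induct) (auto intro: algebraic_int_mult int_imp_algebraic_int)

section \<open>Divisibility of products of leading and of constant coefficients\<close>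

lemma algebraic_int_lead_coeff_mult_root:
  fixes x :: "'a :: field_char_0"
  assumes "p \<noteq> 0" and root: "poly (map_poly of_int p) x = 0"
  shows "algebraic_int (of_int (lead_coeff p) * x)"
proof -
  define m where "m = degree p"
  define a where "a = coeff p m"
  have m: "m > 0"
    using assms by (auto simp: m_def map_poly_pCons elim!: degree_eq_zeroE intro!: Nat.gr0I)
  \<comment> \<open>The polynomial \<open>q\<close> is chosen so that q(a x) = a^(m-1) p(x). Its top
    coefficient is set to 1 separately, since there the exponent m - 1 - i would be -1.\<close>
  define q where "q = monom 1 m + (\<Sum>i<m. monom (coeff p i * a ^ (m - 1 - i)) i)"
  have coeff_q: "coeff q k = (if k = m then 1 else if k < m then coeff p k * a ^ (m - 1 - k) else 0)" for k
    by (simp add: q_def coeff_sum)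
  have deg: "degree q = m"
    by (rule antisym) (auto intro!: degree_le le_degree simp: coeff_q)
  have "poly (map_poly of_int q) (of_int a * x) =
      (\<Sum>i<m. of_int (coeff q i) * (of_int a * x) ^ i) + (of_int a * x) ^ m"
    by (simp add: poly_altdef degree_map_poly coeff_map_poly deg coeff_q flip: lessThan_Suc_atMost)
  also have "(\<Sum>i<m. of_int (coeff q i) * (of_int a * x) ^ i) =
      of_int a ^ (m - 1) * (\<Sum>i<m. of_int (coeff p i) * x ^ i)"
  proof -
    have "of_int (coeff q i) * (of_int a * x) ^ i = of_int a ^ (m - 1) * (of_int (coeff p i) * x ^ i)"
      if "i < m" for i
    proof -
      have "(of_int a :: 'a) ^ (m - 1) = of_int a ^ (m - 1 - i) * of_int a ^ i"
        using that by (simp flip: power_add)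
      thus ?thesis using that by (simp add: coeff_q power_mult_distrib mult_ac)
    qed
    thus ?thesis by (simp add: sum_distrib_left)
  qed
  also have "(of_int a * x) ^ m = of_int a ^ (m - 1) * (of_int a * x ^ m)"
    using m by (cases m) (simp_all add: power_mult_distrib mult_ac)
  also have "of_int a ^ (m - 1) * (\<Sum>i<m. of_int (coeff p i) * x ^ i) + \<dots> =
      of_int a ^ (m - 1) * poly (map_poly of_int p) x"
    by (simp add: poly_altdef degree_map_poly coeff_map_poly a_def distrib_left
        flip: lessThan_Suc_atMost m_def)
  finally have "poly (map_poly of_int q) (of_int a * x) = 0" using root by simp
  moreover have "lead_coeff q = 1" by (simp add: deg coeff_q)
  ultimately show ?thesis unfolding algebraic_int_altdef_ipoly a_def m_def by blast
qed

lemma denominator_dvd_prod_lead_coeff: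
  fixes \<alpha> :: "'b \<Rightarrow> complex" and p :: "'b \<Rightarrow> int poly"
  assumes p: "\<And>n. n \<in> A \<Longrightarrow> p n \<noteq> 0 \<and> poly (map_poly of_int (p n)) (\<alpha> n) = 0"
    and prod: "(\<Prod>n\<in>A. \<alpha> n) = of_int r / of_int s" and "coprime r s" "s \<noteq> 0"
  shows "s dvd (\<Prod>n\<in>A. lead_coeff (p n))"
proof -
  let ?L = "\<Prod>n\<in>A. lead_coeff (p n)"
  have "algebraic_int (\<Prod>n\<in>A. of_int (lead_coeff (p n)) * \<alpha> n)"
    by (intro algebraic_int_prod algebraic_int_lead_coeff_mult_root) (use p in auto)
  hence "algebraic_int (of_int (?L * r) / of_int s :: complex)"
    by (simp add: prod.distrib prod)
  moreover have "of_int (?L * r) / of_int s \<in> (\<rat> :: complex set)"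
    by (intro Rats_divide Rats_of_int)
  ultimately have "of_int (?L * r) / of_int s \<in> (\<int> :: complex set)"
    by (rule rational_algebraic_int_is_int)
  then obtain k where "of_int (?L * r) / of_int s = (of_int k :: complex)" by (elim Ints_cases)
  hence "(of_int (?L * r) :: complex) = of_int (k * s)" using assms(4) by (simp add: field_simps)
  hence "?L * r = k * s" by (simp only: of_int_eq_iff)
  hence "s dvd ?L * r" by simp
  thus ?thesis using assms(3) by (simp add: coprime_dvd_mult_left_iff coprime_commute)
qed

lemma map_poly_of_int_reflect_poly:
  "map_poly of_int (reflect_poly p) = (reflect_poly (map_poly of_int p) :: 'a :: {ring_1, ring_char_0} poly)"
  by (intro poly_eqI) (simp add: coeff_map_poly coeff_reflect_poly degree_map_poly)

text \<open>This is the denominator case for the inverses: the reflected polynomial has the root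
  1/\<alpha> and the former constant coefficient as its leading coefficient, and \<open>r\<close>
  and \<open>s\<close> change places.\<close>

lemma numerator_dvd_prod_coeff_0:
  fixes \<alpha> :: "'b \<Rightarrow> complex" and p :: "'b \<Rightarrow> int poly"
  assumes p: "\<And>n. n \<in> A \<Longrightarrow> coeff (p n) 0 \<noteq> 0 \<and> poly (map_poly of_int (p n)) (\<alpha> n) = 0"
    and prod: "(\<Prod>n\<in>A. \<alpha> n) = of_int r / of_int s" and "coprime r s" "r \<noteq> 0"
  shows "r dvd (\<Prod>n\<in>A. coeff (p n) 0)"
proof -
  have "r dvd (\<Prod>n\<in>A. lead_coeff (reflect_poly (p n)))"
  proof (rule denominator_dvd_prod_lead_coeff[where r = s and \<alpha> = "\<lambda>n. inverse (\<alpha> n)"])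
    fix n assume n: "n \<in> A"
    have "\<alpha> n \<noteq> 0"
      using p[OF n] by (auto simp: poly_0_coeff_0 coeff_map_poly)
    thus "reflect_poly (p n) \<noteq> 0 \<and> poly (map_poly of_int (reflect_poly (p n))) (inverse (\<alpha> n)) = 0"
      using p[OF n] by (auto simp: map_poly_of_int_reflect_poly poly_reflect_poly_nz)
  next
    have "(\<Prod>n\<in>A. inverse (\<alpha> n)) = inverse (\<Prod>n\<in>A. \<alpha> n)"
      using prod_inversef[of \<alpha> A] by (simp add: o_def)
    thus "(\<Prod>n\<in>A. inverse (\<alpha> n)) = of_int s / of_int r" by (simp add: prod)
  qed (use assms in \<open>auto simp: coprime_commute\<close>)
  also have "(\<Prod>n\<in>A. lead_coeff (reflect_poly (p n))) = (\<Prod>n\<in>A. coeff (p n) 0)"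
    using p by (intro prod.cong) (auto simp: coeff_reflect_poly)
  finally show ?thesis .
qed

section \<open>Coefficients as lower bounds for the Mahler measure\<close>

lemma log_mahler_poly_ge_lead_coeff: "ln (cmod (lead_coeff f)) \<le> log_mahler_poly f"
proof -
  have "(\<Sum>z\<in>#M. ln (max 1 (cmod z))) \<ge> 0" for M
    by (induction M) auto
  thus ?thesis by (simp add: log_mahler_poly_def)
qed

text \<open>Up to sign the constant coefficient is the leading coefficient times the product of the
  roots, and each root z satisfies |z| \<le> max 1 |z|.\<close>

lemma log_mahler_poly_ge_coeff_0:
  assumes "coeff f 0 \<noteq> 0"
  shows "ln (cmod (coeff f 0)) \<le> log_mahler_poly f"
proof -
  have "f \<noteq> 0" using assms by auto
  have "coeff f 0 = poly (Polynomial.smult (lead_coeff f) (\<Prod>z\<in>#proots f. [:-z, 1:])) 0"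
    by (simp only: complex_poly_decompose_multiset poly_0_coeff_0)
  also have "\<dots> = lead_coeff f * (\<Prod>z\<in>#proots f. - z)"
    by (simp add: poly_prod_mset image_mset.compositionality o_def)
  finally have f0: "coeff f 0 = lead_coeff f * (\<Prod>z\<in>#proots f. - z)" .
  \<comment> \<open>The exponential form lets the induction run over arbitrary multisets, which may
    contain 0. Logarithms are taken only once the product of the roots is known to be
    nonzero.\<close>
  have "cmod (\<Prod>z\<in>#M. - z) \<le> exp (\<Sum>z\<in>#M. ln (max 1 (cmod z)))" for M
    by (induction M) (auto simp: norm_mult exp_add intro!: mult_mono)
  moreover have "cmod (\<Prod>z\<in>#proots f. - z) > 0"
    using f0 assms by (metis mult_zero_right zero_less_norm_iff)
  ultimately have "ln (cmod (\<Prod>z\<in>#proots f. - z)) \<le> (\<Sum>z\<in>#proots f. ln (max 1 (cmod z)))"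
    by (metis ln_exp ln_mono)
  moreover have "ln (cmod (coeff f 0)) = ln (cmod (lead_coeff f)) + ln (cmod (\<Prod>z\<in>#proots f. - z))"
    using f0 assms \<open>f \<noteq> 0\<close> by (simp add: norm_mult ln_mult)
  ultimately show ?thesis by (simp add: log_mahler_poly_def)
qed

lemma is_min_int_poly_min_int_poly:
  assumes "algebraic x"
  shows "is_min_int_poly x (min_int_poly x)"
  using theI'[OF ex1_min_int_poly[OF assms]] by (simp add: min_int_poly_def)

text \<open>Otherwise the indeterminate would divide the irreducible \<open>p\<close>, so
  \<open>p\<close> would be a unit multiple of it and have 0 as its only root.\<close>

lemma is_min_int_poly_coeff_0_nonzero:
  assumes p: "is_min_int_poly x p" and "x \<noteq> 0"
  shows "coeff p 0 \<noteq> 0"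
proof
  assume "coeff p 0 = 0"
  then obtain q where q: "p = [:0, 1:] * q"
    by (cases p) auto
  have "irreducible p" and root: "poly (map_poly of_int p) x = 0"
    using p by (auto simp: is_min_int_poly_def)
  with q have "[:0, 1 :: int:] dvd 1 \<or> q dvd 1" by (meson irreducibleD)
  hence "q dvd 1" by (auto simp: is_unit_poly_iff)
  then obtain c where "q = [:c:]" "c dvd 1" by (auto simp: is_unit_poly_iff)
  with root q \<open>x \<noteq> 0\<close> show False by (auto simp: map_poly_pCons)
qed

section \<open>From algebraic to integer factorizations\<close>

text \<open>By induction on \<open>A\<close>: a divisor of a product of two naturals splits into a
  divisor of each factor.\<close>

lemma dvd_prod_imp_prod_of_dvd:
  fixes r :: nat
  assumes "finite A" "r dvd (\<Prod>n\<in>A. b n)"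
  obtains d where "\<And>n. n \<in> A \<Longrightarrow> d n dvd b n" "(\<Prod>n\<in>A. d n) = r"
proof -
  have "\<exists>d. (\<forall>n\<in>A. d n dvd b n) \<and> (\<Prod>n\<in>A. d n) = r"
    using assms
  proof (induction A arbitrary: r rule: finite_induct)
    case (insert x F)
    then obtain u v where uv: "r = u * v" "u dvd b x" "v dvd (\<Prod>n\<in>F. b n)"
      using division_decomp[of r "b x" "\<Prod>n\<in>F. b n"] by auto
    from insert.IH[OF uv(3)] obtain d where d: "\<forall>n\<in>F. d n dvd b n" "(\<Prod>n\<in>F. d n) = v" by blast
    have "(\<Prod>n\<in>F. (d(x := u)) n) = v"
      using d(2) insert.hyps by (metis fun_upd_other prod.cong)
    thus ?case
      using insert.hyps uv d by (intro exI[of _ "d(x := u)"]) auto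
  qed auto
  thus ?thesis using that by blast
qed

lemma factor_pos_if_prod_pos:
  fixes f :: "'b \<Rightarrow> nat"
  assumes "finite A" "0 < (\<Prod>n\<in>A. f n)" "n \<in> A"
  shows "0 < f n"
  using assms by simp

lemma integer_factorization_le_log_mahler:
  fixes \<alpha> :: "'b \<Rightarrow> complex" and r s :: nat
  assumes "finite A" and \<alpha>: "\<And>n. n \<in> A \<Longrightarrow> algebraic (\<alpha> n) \<and> \<alpha> n \<noteq> 0"
    and prod: "(\<Prod>n\<in>A. \<alpha> n) = of_nat r / of_nat s"
    and "coprime r s" "r > 0" "s > 0"
  obtains r' s' :: "'b \<Rightarrow> nat" where "(\<Prod>n\<in>A. r' n) = r" "(\<Prod>n\<in>A. s' n) = s"
    "\<And>n. n \<in> A \<Longrightarrow> ln (max (r' n) (s' n)) \<le> log_mahler (\<alpha> n)"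
proof -
  define p where "p n = min_int_poly (\<alpha> n)" for n
  have p: "is_min_int_poly (\<alpha> n) (p n)" if "n \<in> A" for n
    using \<alpha>[OF that] by (simp add: p_def is_min_int_poly_min_int_poly)
  have lc: "lead_coeff (p n) \<noteq> 0" if "n \<in> A" for n
    using p[OF that] by (auto simp: is_min_int_poly_def)
  have c0: "coeff (p n) 0 \<noteq> 0" if "n \<in> A" for n
    using is_min_int_poly_coeff_0_nonzero p \<alpha> that by blast
  have root: "poly (map_poly of_int (p n)) (\<alpha> n) = 0" if "n \<in> A" for n
    using p[OF that] by (simp add: is_min_int_poly_def)
  have prod': "(\<Prod>n\<in>A. \<alpha> n) = of_int (int r) / of_int (int s)"
    by (simp add: prod)
  have "int s dvd (\<Prod>n\<in>A. lead_coeff (p n))"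
    by (rule denominator_dvd_prod_lead_coeff[OF _ prod']) (use assms lc root in auto)
  \<comment> \<open>Absolute values move the divisibility to the naturals, where the splitting lemma
    applies and yields factors without signs.\<close>
  hence "int s dvd int (\<Prod>n\<in>A. nat \<bar>lead_coeff (p n)\<bar>)"
    by (simp flip: abs_prod)
  hence "s dvd (\<Prod>n\<in>A. nat \<bar>lead_coeff (p n)\<bar>)" by (simp only: int_dvd_int_iff)
  then obtain s' where s': "\<And>n. n \<in> A \<Longrightarrow> s' n dvd nat \<bar>lead_coeff (p n)\<bar>" "(\<Prod>n\<in>A. s' n) = s"
    using dvd_prod_imp_prod_of_dvd \<open>finite A\<close> by blast
  have "int r dvd (\<Prod>n\<in>A. coeff (p n) 0)"
    by (rule numerator_dvd_prod_coeff_0[OF _ prod']) (use assms c0 root in auto)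
  hence "int r dvd int (\<Prod>n\<in>A. nat \<bar>coeff (p n) 0\<bar>)"
    by (simp flip: abs_prod)
  hence "r dvd (\<Prod>n\<in>A. nat \<bar>coeff (p n) 0\<bar>)" by (simp only: int_dvd_int_iff)
  then obtain r' where r': "\<And>n. n \<in> A \<Longrightarrow> r' n dvd nat \<bar>coeff (p n) 0\<bar>" "(\<Prod>n\<in>A. r' n) = r"
    using dvd_prod_imp_prod_of_dvd \<open>finite A\<close> by blast
  have "ln (max (r' n) (s' n)) \<le> log_mahler (\<alpha> n)" if n: "n \<in> A" for n
  proof -
    let ?f = "map_poly of_int (p n) :: complex poly"
    have "r' n > 0" "s' n > 0"
      using r'(1)[OF n] s'(1)[OF n] lc[OF n] c0[OF n] by (auto intro!: Nat.gr0I)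
    have "r' n \<le> nat \<bar>coeff (p n) 0\<bar>"
      using r'(1)[OF n] c0[OF n] by (intro dvd_imp_le) auto
    hence "real (r' n) \<le> cmod (coeff ?f 0)"
      by (simp add: coeff_map_poly le_nat_iff)
    hence "ln (r' n) \<le> ln (cmod (coeff ?f 0))"
      using \<open>r' n > 0\<close> by (simp add: ln_mono)
    also have "\<dots> \<le> log_mahler (\<alpha> n)"
      unfolding log_mahler_def p_def[symmetric]
      using c0[OF n] by (intro log_mahler_poly_ge_coeff_0) (simp add: coeff_map_poly)
    finally have 1: "ln (r' n) \<le> log_mahler (\<alpha> n)" .
    have "s' n \<le> nat \<bar>lead_coeff (p n)\<bar>"
      using s'(1)[OF n] lc[OF n] by (intro dvd_imp_le) auto
    hence "real (s' n) \<le> cmod (lead_coeff ?f)"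
      by (simp add: coeff_map_poly degree_map_poly le_nat_iff)
    hence "ln (s' n) \<le> ln (cmod (lead_coeff ?f))"
      using \<open>s' n > 0\<close> by (simp add: ln_mono)
    also have "\<dots> \<le> log_mahler (\<alpha> n)"
      unfolding log_mahler_def p_def[symmetric] by (rule log_mahler_poly_ge_lead_coeff)
    finally show ?thesis using 1 by (simp add: max_def)
  qed
  with r' s' show ?thesis using that by blast
qed

lemma log_mahler_of_nat_divide:
  fixes r s :: nat
  assumes "coprime r s" "r > 0" "s > 0"
  shows "log_mahler (of_nat r / of_nat s) = ln (max r s)"
  using log_mahler_rational[of "int r" "int s"] assms by (simp flip: of_nat_max)

section \<open>Finiteness of the set of sums\<close>

text \<open>Although \<open>N\<close> is unbounded, \<open>g 1 = 0\<close> removes the trivial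
  pairs. A sum is then determined by how often each value k from 2 to \<open>max r s\<close> occurs
  as a maximum, and these multiplicities are bounded by \<open>r * s\<close>.\<close>

lemma finite_factorization_sums:
  fixes g :: "nat \<Rightarrow> real" and r s :: nat
  assumes "r > 0" "s > 0" and g: "g 1 = 0"
  shows "finite {(\<Sum>n=1..N. g (max (r' n) (s' n))) | N r' s'.
    (\<Prod>n=1..N. r' n) = r \<and> (\<Prod>n=1..(N::nat). s' n) = s}" (is "finite ?V")
proof -
  let ?K = "{2..max r s}"
  have "?V \<subseteq> (\<lambda>c. \<Sum>k\<in>?K. real (c k) * g k) ` (?K \<rightarrow>\<^sub>E {..r * s})"
  proof
    fix v assume "v \<in> ?V"
    then obtain N :: nat and r' s' where v: "v = (\<Sum>n=1..N. g (max (r' n) (s' n)))"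
      and r: "(\<Prod>n=1..N. r' n) = r" and s: "(\<Prod>n=1..N. s' n) = s" by blast
    define q where "q n = max (r' n) (s' n)" for n
    define S where "S k = {n\<in>{1..N}. q n = k}" for k
    have r'0: "r' n > 0" and s'0: "s' n > 0" if "n \<in> {1..N}" for n
      using that r s assms(1,2) by (metis factor_pos_if_prod_pos finite_atLeastAtMost)+
    have r'le: "r' n \<le> r" and s'le: "s' n \<le> s" if "n \<in> {1..N}" for n
      using that r s assms(1,2) by (auto intro!: dvd_imp_le)
    have card: "card (S k) \<le> r * s" if "k \<ge> 2" for k
    proof -
      \<comment> \<open>Every index in \<open>S k\<close> contributes a factor of at least 2 to
        \<open>r * s\<close>, so even \<open>2 ^ card (S k)\<close> is bounded by
        \<open>r * s\<close>.\<close>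
      have "card (S k) \<le> 2 ^ card (S k)" by (simp add: less_imp_le)
      also have "\<dots> = (\<Prod>n\<in>S k. 2)" by simp
      also have "\<dots> \<le> (\<Prod>n\<in>S k. r' n * s' n)"
      proof (rule prod_mono)
        fix n assume n: "n \<in> S k"
        hence "r' n \<ge> 1" "s' n \<ge> 1" "max (r' n) (s' n) \<ge> 2"
          using r'0[of n] s'0[of n] that by (auto simp: S_def q_def)
        moreover have "max (r' n) (s' n) \<le> r' n * s' n"
          using calculation by auto
        ultimately show "0 \<le> (2::nat) \<and> 2 \<le> r' n * s' n" by linarith
      qed
      also have "\<dots> \<le> (\<Prod>n=1..N. r' n * s' n)"
        using r'0 s'0 by (intro dvd_imp_le prod_dvd_prod_subset prod_pos) (auto simp: S_def)
      also have "\<dots> = r * s" by (simp only: prod.distrib r s)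
      finally show ?thesis .
    qed
    have "v = (\<Sum>n\<in>{n\<in>{1..N}. q n \<noteq> 1}. g (q n))"
      unfolding v q_def[symmetric] using g by (intro sum.mono_neutral_right) auto
    also have "\<dots> = (\<Sum>k\<in>?K. \<Sum>n\<in>{n\<in>{n\<in>{1..N}. q n \<noteq> 1}. q n = k}. g (q n))"
    proof (rule sum.group[symmetric])
      show "q ` {n \<in> {1..N}. q n \<noteq> 1} \<subseteq> ?K"
      proof safe
        fix n assume n: "n \<in> {1..N}" "q n \<noteq> 1"
        have "q n \<ge> 1" using r'0[OF n(1)] by (simp add: q_def)
        moreover have "q n \<le> max r s" using r'le[OF n(1)] s'le[OF n(1)] by (auto simp: q_def)
        ultimately show "q n \<in> ?K" using n(2) by auto
      qed
    qed auto
    also have "\<dots> = (\<Sum>k\<in>?K. real (card (S k)) * g k)"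
    proof (rule sum.cong[OF refl])
      fix k assume "k \<in> ?K"
      hence "{n\<in>{n\<in>{1..N}. q n \<noteq> 1}. q n = k} = S k" by (auto simp: S_def)
      thus "(\<Sum>n\<in>{n\<in>{n\<in>{1..N}. q n \<noteq> 1}. q n = k}. g (q n)) = real (card (S k)) * g k"
        by (simp add: S_def)
    qed
    \<comment> \<open>Restricting the counting function to \<open>?K\<close> makes it extensional,
      hence a member of the finite function space.\<close>
    finally have "v = (\<Sum>k\<in>?K. real (restrict (\<lambda>k. card (S k)) ?K k) * g k)" by simp
    moreover have "restrict (\<lambda>k. card (S k)) ?K \<in> ?K \<rightarrow>\<^sub>E {..r * s}"
      using card by auto
    ultimately show "v \<in> (\<lambda>c. \<Sum>k\<in>?K. real (c k) * g k) ` (?K \<rightarrow>\<^sub>E {..r * s})" by blast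
  qed
  thus ?thesis by (rule finite_subset) (intro finite_imageI finite_PiE, auto)
qed

section \<open>The infimum as a minimum over integer factorizations\<close>

lemma log_mahler_1: "log_mahler 1 = 0"
  using log_mahler_rational[of 1 1] by simp

lemma seq_norm_eq_sum:
  assumes "finite A" "\<And>n. n \<notin> A \<Longrightarrow> x n = 0"
  shows "seq_norm (ereal t) x = (\<Sum>n\<in>A. \<bar>x n\<bar> powr t) powr (1 / t)"
proof -
  have "(\<Sum>n. \<bar>x n\<bar> powr t) = (\<Sum>n\<in>A. \<bar>x n\<bar> powr t)"
    using assms by (intro suminf_finite) auto
  thus ?thesis by (simp add: seq_norm_def)
qed

theorem theorem2p2:
  fixes t :: real and r s :: nat
  assumes "t > 0" and "r > 0" and "s > 0" and "coprime r s"
    and rational_attainment: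
      "\<forall>(\<alpha>::rat) (u::ereal). \<alpha> \<noteq> 0 \<longrightarrow> 0 < u \<longrightarrow>
         (\<exists>(N::nat) (\<beta> :: nat \<Rightarrow> rat). N \<ge> 1 \<and> (\<forall>n\<in>{1..N}. \<beta> n \<noteq> 0) \<and>
            (if u = \<infinity>
             then metric_mahler u (of_rat \<alpha>) = (MAX n\<in>{1..N}. log_mahler (of_rat (\<beta> n)))
             else metric_mahler u (of_rat \<alpha>) powr real_of_ereal u =
                    (\<Sum>n=1..N. log_mahler (of_rat (\<beta> n)) powr real_of_ereal u)))"
  shows "\<exists>(N::nat) (r' :: nat \<Rightarrow> nat) (s' :: nat \<Rightarrow> nat).
           N \<ge> 1 \<and> (\<forall>n\<in>{1..N}. r' n > 0 \<and> s' n > 0) \<and>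
           metric_mahler (ereal t) (of_nat r / of_nat s) powr t =
             (\<Sum>n=1..N. log_mahler (of_nat (r' n) / of_nat (s' n)) powr t) \<and>
           r = (\<Prod>n=1..N. r' n) \<and> s = (\<Prod>n=1..N. s' n)"
proof -
  define g where "g k = ln (real k) powr t" for k
  define V where "V = {(\<Sum>n=1..N. g (max (r' n) (s' n))) | N r' s'.
    N \<ge> 1 \<and> (\<Prod>n=1..N. r' n) = r \<and> (\<Prod>n=1..(N::nat). s' n) = s}"
  have "finite V"
    unfolding V_def
    by (rule finite_subset[OF _ finite_factorization_sums[of r s g]])
       (use assms in \<open>auto simp: g_def\<close>)
  \<comment> \<open>The factorization with the single pair \<open>r\<close>, \<open>s\<close> shows
    that \<open>V\<close> is nonempty, so that its minimum belongs to it.\<close>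
  have "(\<Sum>n=1..(1::nat). g (max r s)) \<in> V"
    unfolding V_def
    by (rule CollectI, rule exI[of _ "1::nat"], rule exI[of _ "\<lambda>_. r"], rule exI[of _ "\<lambda>_. s"]) simp
  hence "Min V \<in> V" using \<open>finite V\<close> by (intro Min_in) auto
  then obtain N :: nat and r' s' where V: "Min V = (\<Sum>n=1..N. g (max (r' n) (s' n)))"
    and N: "N \<ge> 1" and r: "(\<Prod>n=1..N. r' n) = r" and s: "(\<Prod>n=1..N. s' n) = s"
    unfolding V_def by blast
  have pos: "r' n > 0" "s' n > 0" and log: "log_mahler (of_nat (r' n) / of_nat (s' n)) = ln (max (r' n) (s' n))"
    if n: "n \<in> {1..N}" for n
  proof -
    show *: "r' n > 0" "s' n > 0"
      using n r s assms(2,3) by (metis factor_pos_if_prod_pos finite_atLeastAtMost)+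
    \<comment> \<open>Divisors of coprime numbers are coprime, so each fraction is in lowest terms
      and its Mahler measure is the logarithm of the maximum.\<close>
    have "r' n dvd r" "s' n dvd s" using n r s by auto
    hence "coprime (r' n) (s' n)" using \<open>coprime r s\<close> coprime_divisors by blast
    thus "log_mahler (of_nat (r' n) / of_nat (s' n)) = ln (max (r' n) (s' n))"
      using * by (rule log_mahler_of_nat_divide)
  qed
  have sum: "Min V = (\<Sum>n=1..N. log_mahler (of_nat (r' n) / of_nat (s' n)) powr t)"
    unfolding V g_def using log by (intro sum.cong) auto
  \<comment> \<open>The value is attained by the optimal integer factorization, and every algebraic
    factorization is bounded below by the sum of some integer factorization.\<close>
  have "metric_mahler (ereal t) (of_nat r / of_nat s) = Min V powr (1 / t)"
    unfolding metric_mahler_def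
  proof (rule cInf_eq_minimum)
    define a :: "nat \<Rightarrow> complex" where
      "a n = (if n \<in> {1..N} then of_nat (r' n) / of_nat (s' n) else 1)" for n
    \<comment> \<open>Some of the fractions may equal 1, so the nontrivial indices can form a proper
      subset of \<open>{1..N}\<close>.\<close>
    have "(\<Prod>n | a n \<noteq> 1. a n) = (\<Prod>n=1..N. a n)"
      by (rule prod.mono_neutral_left) (auto simp: a_def)
    also have "\<dots> = of_nat r / of_nat s"
      by (simp add: a_def prod_dividef flip: r s)
    finally have "(\<Prod>n | a n \<noteq> 1. a n) = of_nat r / of_nat s" .
    moreover have "finite {n. a n \<noteq> 1}"
      by (rule finite_subset[of _ "{1..N}"]) (auto simp: a_def)
    moreover have "algebraic (a n) \<and> a n \<noteq> 0" for n
      using pos[of n] by (auto simp: a_def intro!: rat_imp_algebraic Rats_divide)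
    ultimately have "a \<in> alg_factorizations (of_nat r / of_nat s)"
      by (simp add: alg_factorizations_def)
    moreover have "seq_norm (ereal t) (\<lambda>n. log_mahler (a n)) = Min V powr (1 / t)"
    proof -
      have "seq_norm (ereal t) (\<lambda>n. log_mahler (a n)) =
          (\<Sum>n=1..N. \<bar>log_mahler (a n)\<bar> powr t) powr (1 / t)"
        by (rule seq_norm_eq_sum) (auto simp: a_def log_mahler_1)
      also have "(\<Sum>n=1..N. \<bar>log_mahler (a n)\<bar> powr t) = Min V"
        unfolding V g_def
      proof (rule sum.cong[OF refl])
        fix n assume n: "n \<in> {1..N}"
        have "ln (real (max (r' n) (s' n))) \<ge> 0"
          using pos[OF n] by (intro ln_ge_zero) (auto simp: max_def)
        thus "\<bar>log_mahler (a n)\<bar> powr t = ln (real (max (r' n) (s' n))) powr t"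
          using n log[OF n] by (simp add: a_def)
      qed
      finally show ?thesis .
    qed
    ultimately show "Min V powr (1 / t) \<in>
        (\<lambda>a. seq_norm (ereal t) (\<lambda>n. log_mahler (a n))) ` alg_factorizations (of_nat r / of_nat s)"
      by (metis (no_types, lifting) image_eqI)
  next
    fix y
    assume "y \<in> (\<lambda>a. seq_norm (ereal t) (\<lambda>n. log_mahler (a n))) ` alg_factorizations (of_nat r / of_nat s)"
    then obtain a where y: "y = seq_norm (ereal t) (\<lambda>n. log_mahler (a n))"
      and a: "\<And>n. algebraic (a n) \<and> a n \<noteq> 0" and fin: "finite {n. a n \<noteq> 1}"
      and prod: "(\<Prod>n | a n \<noteq> 1. a n) = of_nat r / of_nat s"
      by (auto simp: alg_factorizations_def)
    obtain M0 where "{n. a n \<noteq> 1} \<subseteq> {..<M0}"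
      using fin finite_nat_bounded by blast
    \<comment> \<open>Taking \<open>Suc M0\<close> ensures at least one factor, as membership in
      \<open>V\<close> demands, even if all \<open>a n\<close> are 1.\<close>
    then obtain M where M: "{n. a n \<noteq> 1} \<subseteq> {..<M}" "M \<ge> 1"
      by (intro that[of "Suc M0"]) auto
    \<comment> \<open>The shift passes from indices starting at 0 to the range \<open>{1..M}\<close>
      used in \<open>V\<close>.\<close>
    define b where "b n = a (n - 1)" for n
    have b_shift: "(\<Prod>n=1..M. b n) = (\<Prod>n<M. a n)"
      unfolding b_def by (rule prod.reindex_bij_witness[of _ Suc "\<lambda>n. n - 1"]) auto
    have "(\<Prod>n<M. a n) = of_nat r / of_nat s"
      unfolding prod[symmetric] using M by (intro prod.mono_neutral_right) auto
    hence "(\<Prod>n=1..M. b n) = of_nat r / of_nat s" by (simp only: b_shift)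
    then obtain u v :: "nat \<Rightarrow> nat" where uv: "(\<Prod>n=1..M. u n) = r" "(\<Prod>n=1..M. v n) = s"
      and le: "\<And>n. n \<in> {1..M} \<Longrightarrow> ln (max (u n) (v n)) \<le> log_mahler (b n)"
      using integer_factorization_le_log_mahler[of "{1..M}" b r s] a assms by (auto simp: b_def)
    have "Min V \<le> (\<Sum>n=1..M. g (max (u n) (v n)))"
      using \<open>finite V\<close> uv \<open>M \<ge> 1\<close> by (intro Min_le) (auto simp: V_def)
    also have "\<dots> \<le> (\<Sum>n=1..M. \<bar>log_mahler (b n)\<bar> powr t)"
      unfolding g_def
    proof (rule sum_mono)
      fix n assume n: "n \<in> {1..M}"
      have "u n > 0" using n uv assms(2) by (metis factor_pos_if_prod_pos finite_atLeastAtMost)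
      hence "ln (real (max (u n) (v n))) \<ge> 0" by (intro ln_ge_zero) (auto simp: max_def)
      thus "ln (real (max (u n) (v n))) powr t \<le> \<bar>log_mahler (b n)\<bar> powr t"
        using le[OF n] assms by (intro powr_mono2) auto
    qed
    also have "\<dots> = (\<Sum>n<M. \<bar>log_mahler (a n)\<bar> powr t)"
      unfolding b_def by (rule sum.reindex_bij_witness[of _ Suc "\<lambda>n. n - 1"]) auto
    finally have "Min V \<le> (\<Sum>n<M. \<bar>log_mahler (a n)\<bar> powr t)" .
    moreover have "Min V \<ge> 0" unfolding sum by (intro sum_nonneg) auto
    moreover have "y = (\<Sum>n<M. \<bar>log_mahler (a n)\<bar> powr t) powr (1 / t)"
      unfolding y
    proof (rule seq_norm_eq_sum)
      fix n assume "n \<notin> {..<M}"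
      hence "a n = 1" using M by blast
      thus "log_mahler (a n) = 0" by (simp add: log_mahler_1)
    qed simp
    ultimately show "Min V powr (1 / t) \<le> y"
      using assms by (simp add: powr_mono2)
  qed
  \<comment> \<open>Nonnegativity is what makes the powers 1/t and t cancel:
    \<open>x powr 1 = x\<close> holds for nonnegative \<open>x\<close>.\<close>
  moreover have "Min V \<ge> 0" unfolding sum by (intro sum_nonneg) auto
  ultimately have eq: "metric_mahler (ereal t) (of_nat r / of_nat s) powr t = Min V"
    using assms by (simp add: powr_powr)
  show ?thesis
    by (rule exI[of _ N], rule exI[of _ r'], rule exI[of _ s']) (use eq sum N pos r s in auto)
qed

end
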